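(* Let $K\ge 1$, $\mathcal{K}=\{1,\dots,K\}$, and let $B,L,N_0>0$ and, for each $k\in\mathcal{K}$, $h_k>0$, $T_k>0$ and $\beta_k=1$ be given. Consider the optimization problem $$ \begin{aligned} \min_{\{\gamma_k,t_k\}_{k\in\mathcal K}}\quad &\sum_{k=1}^K\frac{\gamma_kBt_kN_0}{h_k^2}\left(2^{\frac{\beta_kL}{\gamma_kBt_k}}-1\right)\\ \text{s.t.}\quad &\sum_{k=1}^K\gamma_k=1,\quad 0\le\gamma_k\le 1,\ k\in\mathcal{K},\\ &0\le t_k\le T_k,\ k\in\mathcal{K}. \end{aligned} $$ The optimal solution is $$ \gamma_k^{\star}=\frac{\beta_kL\ln 2}{BT_k\left[1+\mathcal{W}\left(\frac{h_k^2\nu^{\star}-BT_kN_0}{BT_kN_0e}\right)\right]},\qquad t_k^{\star}=T_k,\qquad \forall k\in\mathcal{K}, $$ where $\mathcal{W}$ is the Lambert $W$ function, $e$ is Euler's number, and $\nu^{\star}$ is the value of the Lagrange multiplier associated with the constraint $\sum_{k}\gamma_k=1$, i.e. the real number determined by $$\sum_{k=1}^K\frac{\beta_kL\ln 2}{BT_k\left[1+\mathcal{W}\left(\frac{h_k^2\nu^{\star}-BT_kN_0}{BT_kN_0e}\right)\right]}=1 .$$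
   Context: Interpretation: $K$ edge devices upload a model of $L$ bits over total bandwidth $B$; $\gamma_k$ is the fraction of bandwidth of device $k$, $h_k$ its channel gain, $N_0$ the noise variance, $t_k$ its uploading time, $T_k=T-t_k^{\text{comp}}$ its maximal allowed uploading time (total round time $T$ minus local training time $t_k^{\text{comp}}$), and $\beta_k=1$ indicates that device $k$ is active. The $k$-th summand of the objective is the uploading energy of device $k$. Convention: a summand of the objective with $\gamma_k t_k=0$ has the value $+\infty$ (its limit as $\gamma_kt_k\to 0^+$). $\mathcal{W}$ denotes the principal real branch of the Lambert $W$ function, i.e. the inverse of $w\mapsto we^w$ on $[-1,\infty)$, defined on $[-1/e,\infty)$. *)

theory Defs
  imports Complex_Main "HOL-Library.Extended_Real"
begin

text \<open>Principal real branch of the Lambert function; only meaningful on \<open>[-1/e, \<infinity>)\<close>.\<close>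

definition lambert_W :: "real \<Rightarrow> real" where
  "lambert_W = inv_into {-1..} (\<lambda>w. w * exp w)"

text \<open>
  \<open>upload_energy B L N0 h b g t\<close> is the energy of one device with channel gain \<open>h\<close>, activity
  indicator \<open>b\<close>, bandwidth fraction \<open>g\<close> and uploading time \<open>t\<close>. For \<open>g * t = 0\<close> division by
  zero would make it \<open>0\<close>; the extended-real version takes the limit \<open>\<infinity>\<close> there instead.
\<close>

definition upload_energy ::
  "real \<Rightarrow> real \<Rightarrow> real \<Rightarrow> real \<Rightarrow> real \<Rightarrow> real \<Rightarrow> real \<Rightarrow> real" where
  "upload_energy B L N0 h b g t =
     g * B * t * N0 / h\<^sup>2 * (2 powr (b * L / (g * B * t)) - 1)"

definition upload_energy_ext ::
  "real \<Rightarrow> real \<Rightarrow> real \<Rightarrow> real \<Rightarrow> real \<Rightarrow> real \<Rightarrow> real \<Rightarrow> ereal" where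
  "upload_energy_ext B L N0 h b g t =
     (if g * t = 0 then \<infinity> else ereal (upload_energy B L N0 h b g t))"

definition total_energy ::
  "nat \<Rightarrow> real \<Rightarrow> real \<Rightarrow> real \<Rightarrow> (nat \<Rightarrow> real) \<Rightarrow> (nat \<Rightarrow> real) \<Rightarrow>
   (nat \<Rightarrow> real) \<Rightarrow> (nat \<Rightarrow> real) \<Rightarrow> ereal" where
  "total_energy K B L N0 h \<beta> \<gamma> t =
     (\<Sum>k=1..K. upload_energy_ext B L N0 (h k) (\<beta> k) (\<gamma> k) (t k))"

definition feasible ::
  "nat \<Rightarrow> (nat \<Rightarrow> real) \<Rightarrow> (nat \<Rightarrow> real) \<Rightarrow> (nat \<Rightarrow> real) \<Rightarrow> bool" where
  "feasible K T \<gamma> t \<longleftrightarrow>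
     (\<Sum>k=1..K. \<gamma> k) = 1 \<and>
     (\<forall>k\<in>{1..K}. 0 \<le> \<gamma> k \<and> \<gamma> k \<le> 1) \<and>
     (\<forall>k\<in>{1..K}. 0 \<le> t k \<and> t k \<le> T k)"

definition optimal_solution ::
  "nat \<Rightarrow> real \<Rightarrow> real \<Rightarrow> real \<Rightarrow> (nat \<Rightarrow> real) \<Rightarrow> (nat \<Rightarrow> real) \<Rightarrow> (nat \<Rightarrow> real) \<Rightarrow>
   (nat \<Rightarrow> real) \<Rightarrow> (nat \<Rightarrow> real) \<Rightarrow> bool" where
  "optimal_solution K B L N0 h \<beta> T \<gamma> t \<longleftrightarrow>
     feasible K T \<gamma> t \<and>
     (\<forall>\<gamma>' t'. feasible K T \<gamma>' t' \<longrightarrow>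
        total_energy K B L N0 h \<beta> \<gamma> t \<le> total_energy K B L N0 h \<beta> \<gamma>' t')"

text \<open>
  The Lagrangian of the problem: \<open>\<nu>\<close> belongs to the bandwidth constraint, \<open>a\<close> and \<open>b\<close> to
  \<open>0 \<le> \<gamma> k\<close> and \<open>\<gamma> k \<le> 1\<close>, \<open>c\<close> and \<open>d\<close> to \<open>0 \<le> t k\<close> and \<open>t k \<le> T k\<close>.
\<close>

definition lagrangian ::
  "nat \<Rightarrow> real \<Rightarrow> real \<Rightarrow> real \<Rightarrow> (nat \<Rightarrow> real) \<Rightarrow> (nat \<Rightarrow> real) \<Rightarrow> (nat \<Rightarrow> real) \<Rightarrow>
   real \<Rightarrow> (nat \<Rightarrow> real) \<Rightarrow> (nat \<Rightarrow> real) \<Rightarrow> (nat \<Rightarrow> real) \<Rightarrow> (nat \<Rightarrow> real) \<Rightarrow>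
   (nat \<Rightarrow> real) \<Rightarrow> (nat \<Rightarrow> real) \<Rightarrow> real" where
  "lagrangian K B L N0 h \<beta> T \<nu> a b c d \<gamma> t =
     (\<Sum>k=1..K. upload_energy B L N0 (h k) (\<beta> k) (\<gamma> k) (t k))
     + \<nu> * ((\<Sum>k=1..K. \<gamma> k) - 1)
     - (\<Sum>k=1..K. a k * \<gamma> k) + (\<Sum>k=1..K. b k * (\<gamma> k - 1))
     - (\<Sum>k=1..K. c k * t k) + (\<Sum>k=1..K. d k * (t k - T k))"

text \<open>
  \<open>\<nu>\<close> is the multiplier of the bandwidth constraint in a solution of the Karush--Kuhn--Tucker
  conditions at \<open>(\<gamma>, t)\<close>. The point must have finite energy, so that the real-valued
  Lagrangian agrees with the extended-real objective in a neighbourhood of it.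
\<close>

definition bandwidth_multiplier ::
  "nat \<Rightarrow> real \<Rightarrow> real \<Rightarrow> real \<Rightarrow> (nat \<Rightarrow> real) \<Rightarrow> (nat \<Rightarrow> real) \<Rightarrow> (nat \<Rightarrow> real) \<Rightarrow>
   (nat \<Rightarrow> real) \<Rightarrow> (nat \<Rightarrow> real) \<Rightarrow> real \<Rightarrow> bool" where
  "bandwidth_multiplier K B L N0 h \<beta> T \<gamma> t \<nu> \<longleftrightarrow>
     feasible K T \<gamma> t \<and> (\<forall>k\<in>{1..K}. \<gamma> k * t k \<noteq> 0) \<and>
     (\<exists>a b c d.
        (\<forall>k\<in>{1..K}. 0 \<le> a k \<and> 0 \<le> b k \<and> 0 \<le> c k \<and> 0 \<le> d k) \<and>
        (\<forall>k\<in>{1..K}. a k * \<gamma> k = 0 \<and> b k * (\<gamma> k - 1) = 0 \<and>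
                     c k * t k = 0 \<and> d k * (t k - T k) = 0) \<and>
        (\<forall>k\<in>{1..K}.
           ((\<lambda>x. lagrangian K B L N0 h \<beta> T \<nu> a b c d (\<gamma>(k := x)) t)
              has_real_derivative 0) (at (\<gamma> k)) \<and>
           ((\<lambda>x. lagrangian K B L N0 h \<beta> T \<nu> a b c d \<gamma> (t(k := x)))
              has_real_derivative 0) (at (t k))))"

definition lambert_arg :: "real \<Rightarrow> real \<Rightarrow> real \<Rightarrow> real \<Rightarrow> real \<Rightarrow> real" where
  "lambert_arg B N0 h T \<nu> = (h\<^sup>2 * \<nu> - B * T * N0) / (B * T * N0 * exp 1)"

definition gamma_star ::
  "real \<Rightarrow> real \<Rightarrow> real \<Rightarrow> (nat \<Rightarrow> real) \<Rightarrow> (nat \<Rightarrow> real) \<Rightarrow> (nat \<Rightarrow> real) \<Rightarrow>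
   real \<Rightarrow> nat \<Rightarrow> real" where
  "gamma_star B L N0 h \<beta> T \<nu> k =
     \<beta> k * L * ln 2 / (B * T k * (1 + lambert_W (lambert_arg B N0 (h k) (T k) \<nu>)))"

text \<open>The equation for \<open>\<nu>\<close>, including that every term in it is defined.\<close>

definition nu_equation ::
  "nat \<Rightarrow> real \<Rightarrow> real \<Rightarrow> real \<Rightarrow> (nat \<Rightarrow> real) \<Rightarrow> (nat \<Rightarrow> real) \<Rightarrow> (nat \<Rightarrow> real) \<Rightarrow>
   real \<Rightarrow> bool" where
  "nu_equation K B L N0 h \<beta> T \<nu> \<longleftrightarrow>
     (\<forall>k\<in>{1..K}. - 1 / exp 1 \<le> lambert_arg B N0 (h k) (T k) \<nu> \<and>
                  1 + lambert_W (lambert_arg B N0 (h k) (T k) \<nu>) \<noteq> 0) \<and>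
     (\<Sum>k=1..K. gamma_star B L N0 h \<beta> T \<nu> k) = 1"

end

theory Submission
  imports Defs
begin

text \<open>
  The energy of a device depends only on \<open>s = \<gamma> * t\<close>, and with \<open>x = L * ln 2 / (B * s)\<close> it is
  \<open>B * N0 / h\<^sup>2 * s * (exp x - 1)\<close>, a strictly decreasing and strictly convex function of \<open>s\<close>;
  both properties reduce to \<open>1 + y < exp y\<close> for \<open>y \<noteq> 0\<close>. The marginal energy with respect to
  \<open>\<gamma>\<close> at \<open>t = T\<close> equals \<open>- \<nu>\<close> iff \<open>(x - 1) * exp (x - 1)\<close> is the argument of the Lambert
  function in the claim, i.e. iff \<open>\<gamma>\<close> is the claimed value. Adding up the tangent-line
  inequalities of the devices, the multiples of \<open>\<nu>\<close> cancel because the \<open>\<gamma> k\<close> sum to \<open>1\<close> on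
  both sides; strictness gives uniqueness. Finally, the claimed bandwidth fractions are continuous
  and strictly decreasing in \<open>\<nu>\<close>, so that \<open>\<nu>\<close> exists by the intermediate value theorem.
\<close>

lemma one_plus_less_exp:
  fixes y :: real
  assumes "y \<noteq> 0"
  shows "1 + y < exp y"
proof (cases "1 + y > 0")
  case True
  then have "ln (1 + y) < y"
    using ln_le_minus_one[of "1 + y"] ln_eq_minus_one[of "1 + y"] assms by fastforce
  then show ?thesis
    using True by (metis exp_less_cancel_iff exp_ln)
next
  case False
  then show ?thesis
    by (meson exp_gt_zero le_less_trans not_le)
qed

subsection \<open>The Lambert function\<close>

text \<open>The derivative \<open>(1 + x) * exp x\<close> vanishes at \<open>-1\<close>, but its
  sign is only needed inside the interval, so the left endpoint \<open>-1\<close> is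
  allowed.\<close>

lemma mult_exp_strict_mono:
  fixes v w :: real
  assumes "-1 \<le> v" "v < w"
  shows "v * exp v < w * exp w"
proof (rule DERIV_pos_imp_increasing_open[OF assms(2)])
  fix x assume x: "v < x" "x < w"
  have "((\<lambda>w. w * exp w) has_real_derivative (1 + x) * exp x) (at x)"
    by (auto intro!: derivative_eq_intros simp: algebra_simps)
  moreover have "(1 + x) * exp x > 0"
    using x assms by simp
  ultimately show "\<exists>y. ((\<lambda>w. w * exp w) has_real_derivative y) (at x) \<and> y > 0"
    by blast
qed (auto intro!: continuous_intros)

lemma inj_on_mult_exp: "inj_on (\<lambda>w::real. w * exp w) {-1..}"
  by (rule linorder_inj_onI) (use mult_exp_strict_mono in fastforce)+

lemma lambert_W_mult_exp:
  "-1 \<le> w \<Longrightarrow> lambert_W (w * exp w) = w"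
  unfolding lambert_W_def using inv_into_f_f[OF inj_on_mult_exp, of w] by simp

lemma lambert_W:
  assumes "- 1 / exp 1 \<le> y"
  shows "-1 \<le> lambert_W y" "lambert_W y * exp (lambert_W y) = y"
proof -
  \<comment> \<open>Intermediate value theorem on \<open>[-1, max 0 y]\<close>: at the left end the
    value is \<open>-1/e\<close>, and at the nonnegative right end \<open>exp\<close> is at least
    \<open>1\<close>.\<close>
  have "\<exists>w\<ge>-1. w \<le> max 0 y \<and> w * exp w = y"
  proof (rule IVT')
    show "- 1 * exp (- 1) \<le> y"
      using assms by (simp add: exp_minus field_simps)
    have "max 0 y * 1 \<le> max 0 y * exp (max 0 y)"
      by (intro mult_left_mono) auto
    then show "y \<le> max 0 y * exp (max 0 y)" by linarith
  qed (auto intro!: continuous_intros)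
  then obtain w where "w \<ge> -1" "w * exp w = y" by blast
  then show "-1 \<le> lambert_W y" "lambert_W y * exp (lambert_W y) = y"
    using lambert_W_mult_exp by auto
qed

lemma lambert_W_strict_mono:
  assumes "- 1 / exp 1 \<le> y" "y < z"
  shows "lambert_W y < lambert_W z"
proof (rule ccontr)
  assume "\<not> lambert_W y < lambert_W z"
  then have "lambert_W z * exp (lambert_W z) \<le> lambert_W y * exp (lambert_W y)"
    using mult_exp_strict_mono[of "lambert_W z" "lambert_W y"] lambert_W(1)[of z] assms
    by (cases "lambert_W z = lambert_W y") auto
  then show False
    using lambert_W(2)[of y] lambert_W(2)[of z] assms by simp
qed

lemma lambert_W_gt_minus_one:
  assumes "- 1 / exp 1 < y"
  shows "-1 < lambert_W y"
  using lambert_W_strict_mono[OF order_refl assms] lambert_W(1)[of "- 1 / exp 1"] by simp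

lemma isCont_lambert_W:
  assumes "- 1 / exp 1 < y"
  shows "isCont lambert_W y"
proof -
  let ?w = "lambert_W y"
  have w: "-1 < ?w" "?w * exp ?w = y"
    using lambert_W_gt_minus_one lambert_W(2)[of y] assms by auto
  have "isCont lambert_W ((\<lambda>w. w * exp w) ?w)"
  \<comment> \<open>The radius \<open>?w + 1\<close> is the largest that keeps the interval around
    \<open>?w\<close> inside \<open>[-1, \<infinity>)\<close>, where \<open>lambert_W\<close> is a
    left inverse. It is positive because \<open>y\<close> avoids the branch point.\<close>
  proof (rule isCont_inverse_function[where d = "?w + 1" and x = ?w and f = "\<lambda>w. w * exp w"])
    show "lambert_W (z * exp z) = z" if "\<bar>z - ?w\<bar> \<le> ?w + 1" for z
      using that by (intro lambert_W_mult_exp) auto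
  qed (use w in \<open>auto intro!: continuous_intros\<close>)
  then show ?thesis using w by simp
qed

subsection \<open>The energy of one device\<close>

text \<open>The derivative of the energy with respect to the product \<open>s\<close>; the marginal
  energy in the bandwidth fraction is this times the uploading time, and vice versa.\<close>

definition energy_slope :: "real \<Rightarrow> real \<Rightarrow> real \<Rightarrow> real \<Rightarrow> real \<Rightarrow> real" where
  "energy_slope B L N0 h s =
     B * N0 / h\<^sup>2 * ((1 - L * ln 2 / (B * s)) * exp (L * ln 2 / (B * s)) - 1)"

lemma upload_energy_eq:
  "upload_energy B L N0 h 1 g t =
     B * N0 / h\<^sup>2 * ((g * t) * (exp (L * ln 2 / (B * (g * t))) - 1))"
  by (simp add: upload_energy_def powr_def mult_ac)

text \<open>Transfers the derivative in the bandwidth fraction to the one in the uploading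
  time.\<close>

lemma upload_energy_commute:
  "upload_energy B L N0 h 1 g t = upload_energy B L N0 h 1 t g"
  by (simp add: upload_energy_eq mult.commute)

text \<open>The tangent inequality of \<open>exp\<close> at \<open>a / r\<close>, evaluated at
  \<open>a / s\<close> and multiplied by \<open>s\<close>, becomes the tangent inequality at
  \<open>r\<close> for the perspective \<open>s * exp (a / s)\<close>.\<close>

lemma tangent_less:
  fixes a s r :: real
  assumes "s > 0" "r > 0" "a > 0" "s \<noteq> r"
  shows "r * (exp (a / r) - 1) + ((1 - a / r) * exp (a / r) - 1) * (s - r)
           < s * (exp (a / s) - 1)"
proof -
  have "a / s \<noteq> a / r"
    using assms by (simp add: field_simps)
  then have "exp (a / r) * (1 + (a / s - a / r)) < exp (a / r) * exp (a / s - a / r)"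
    by (intro mult_strict_left_mono one_plus_less_exp) auto
  also have "\<dots> = exp (a / s)"
    by (simp flip: exp_add)
  finally have "s * (exp (a / r) * (1 + (a / s - a / r))) < s * exp (a / s)"
    using assms by simp
  moreover have "s * (exp (a / r) * (1 + (a / s - a / r))) =
      r * exp (a / r) + (1 - a / r) * exp (a / r) * (s - r)"
    using assms by (simp add: field_simps)
  ultimately show ?thesis by (simp add: algebra_simps)
qed

lemma energy_slope_neg:
  assumes "B > 0" "L > 0" "N0 > 0" "h > 0" "s > 0"
  shows "energy_slope B L N0 h s < 0"
proof -
  define x where "x = L * ln 2 / (B * s)"
  have "x > 0" using assms by (simp add: x_def)
  then have "(1 - x) * exp x < exp (- x) * exp x"
    using one_plus_less_exp[of "- x"] by (intro mult_strict_right_mono) auto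
  then have "(1 - x) * exp x - 1 < 0" by (simp flip: exp_add)
  then show ?thesis
    using assms unfolding energy_slope_def x_def[symmetric]
    by (intro mult_pos_neg) auto
qed

lemma upload_energy_tangent_less:
  assumes "B > 0" "L > 0" "N0 > 0" "h > 0" "g > 0" "t > 0" "g' * t' > 0" "g * t \<noteq> g' * t'"
  shows "upload_energy B L N0 h 1 g' t' + energy_slope B L N0 h (g' * t') * (g * t - g' * t')
           < upload_energy B L N0 h 1 g t"
proof -
  let ?a = "L * ln 2 / B"
  have "B * N0 / h\<^sup>2 * (g' * t' * (exp (?a / (g' * t')) - 1) +
         ((1 - ?a / (g' * t')) * exp (?a / (g' * t')) - 1) * (g * t - g' * t'))
       < B * N0 / h\<^sup>2 * (g * t * (exp (?a / (g * t)) - 1))"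
    using assms by (intro mult_strict_left_mono tangent_less) auto
  then show ?thesis
    by (simp add: upload_energy_eq energy_slope_def distrib_left mult.assoc)
qed

text \<open>With bandwidth priced at \<nu>, the stationary point is the unique minimizer for a
  single device. The energy is not jointly strictly convex in \<open>(g, t)\<close>, so the tangent
  inequality in the product \<open>g * t\<close> is combined with the bound
  \<open>t \<le> T\<close>.\<close>

lemma upload_energy_stationary_less:
  assumes pos: "B > 0" "L > 0" "N0 > 0" "h > 0" "T > 0" "g' > 0"
    and stat: "energy_slope B L N0 h (g' * T) * T = - \<nu>"
    and gt: "g > 0" "0 < t" "t \<le> T" "g \<noteq> g' \<or> t \<noteq> T"
  shows "upload_energy B L N0 h 1 g' T + \<nu> * g' < upload_energy B L N0 h 1 g t + \<nu> * g"
proof -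
  define D where "D = energy_slope B L N0 h (g' * T)"
  have D: "D < 0" "D * T = - \<nu>"
    using energy_slope_neg[of B L N0 h "g' * T"] pos stat by (auto simp: D_def)
  \<comment> \<open>As the slope is negative, raising \<open>t\<close> to \<open>T\<close> can only
    lower the linear term, which then depends on \<open>g\<close> alone.\<close>
  have "D * (g * t - g' * T) \<ge> D * (g * T - g' * T)"
    using D(1) gt by (intro mult_left_mono_neg) auto
  moreover have "D * (g * T - g' * T) = D * T * (g - g')"
    by (simp add: algebra_simps)
  then have "D * (g * T - g' * T) = \<nu> * g' - \<nu> * g"
    unfolding D(2) by (simp add: algebra_simps)
  ultimately have le: "D * (g * t - g' * T) \<ge> \<nu> * g' - \<nu> * g" by simp
  show ?thesis
  proof (cases "g * t = g' * T")
    case False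
    then show ?thesis
      using upload_energy_tangent_less[of B L N0 h g t g' T] pos gt le by (simp add: D_def)
  next
    case True
    \<comment> \<open>Equal products give equal energies, so strictness must come from the price: a
      shorter time forces a larger fraction, and \<nu> is positive.\<close>
    have "t \<noteq> T" using True gt pos by auto
    then have "g * t < g * T" using gt by simp
    then have "g' < g" using True pos by simp
    moreover have "\<nu> > 0" using mult_neg_pos[OF D(1) pos(5)] D(2) by simp
    ultimately show ?thesis
      using True by (simp add: upload_energy_eq)
  qed
qed

lemma has_real_derivative_upload_energy:
  assumes "B > 0" "g * t \<noteq> 0"
  shows "((\<lambda>g. upload_energy B L N0 h 1 g t) has_real_derivative
           energy_slope B L N0 h (g * t) * t) (at g)"
proof -
  let ?f = "\<lambda>s. B * N0 / h\<^sup>2 * (s * (exp (L * ln 2 / (B * s)) - 1))"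
  have "((\<lambda>s. s * (exp (c / s) - 1)) has_real_derivative (1 - c / s) * exp (c / s) - 1) (at s)"
    if "s \<noteq> 0" for c s :: real
    using that by (auto intro!: derivative_eq_intros simp: field_simps)
  from DERIV_cmult[OF this[OF assms(2), of "L * ln 2 / B"], of "B * N0 / h\<^sup>2"]
  have "(?f has_real_derivative energy_slope B L N0 h (g * t)) (at (g * t))"
    by (simp add: energy_slope_def)
  moreover have "((\<lambda>g. g * t) has_real_derivative t) (at g)"
    by (auto intro!: derivative_eq_intros)
  ultimately have "((\<lambda>g. ?f (g * t)) has_real_derivative energy_slope B L N0 h (g * t) * t) (at g)"
    by (rule DERIV_chain2)
  then show ?thesis by (simp add: upload_energy_eq)
qed

subsection \<open>The stationary bandwidth fractions\<close>

text \<open>The argument exceeds \<open>-1/e\<close> by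
  \<open>h\<^sup>2 * \<nu> / (B * T * N0 * e)\<close>, so the branch point is reached exactly at
  \<open>\<nu> = 0\<close>.\<close>

lemma lambert_arg_gt:
  assumes "B > 0" "N0 > 0" "h > 0" "T > 0"
  shows "- (1 / exp 1) < lambert_arg B N0 h T \<nu> \<longleftrightarrow> \<nu> > 0"
  using assms by (auto simp: lambert_arg_def field_simps zero_less_mult_iff)

lemma lambert_arg_strict_mono:
  assumes "B > 0" "N0 > 0" "h > 0" "T > 0" "\<mu> < \<nu>"
  shows "lambert_arg B N0 h T \<mu> < lambert_arg B N0 h T \<nu>"
  using assms unfolding lambert_arg_def by (intro divide_strict_right_mono) auto

lemma lambert_W_lambert_arg_gt:
  assumes "B > 0" "N0 > 0" "h > 0" "T > 0" "\<nu> > 0"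
  shows "-1 < lambert_W (lambert_arg B N0 h T \<nu>)"
  using assms by (intro lambert_W_gt_minus_one) (simp add: lambert_arg_gt)

text \<open>At the branch point \<open>lambert_W\<close> is \<open>-1\<close> and the denominator
  vanishes. Definedness thus means the same for every device, and \<open>K \<ge> 1\<close> supplies
  one device from which \<open>\<nu> > 0\<close> can be read off.\<close>

lemma nu_equation_iff:
  assumes "K \<ge> 1" "B > 0" "N0 > 0"
    and "\<And>k. k \<in> {1..K} \<Longrightarrow> h k > 0" "\<And>k. k \<in> {1..K} \<Longrightarrow> T k > 0"
  shows "nu_equation K B L N0 h \<beta> T \<nu> \<longleftrightarrow>
           \<nu> > 0 \<and> (\<Sum>k=1..K. gamma_star B L N0 h \<beta> T \<nu> k) = 1"
proof -
  have W: "lambert_W (- 1 / exp 1) = - 1"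
    using lambert_W_mult_exp[of "-1"] by (simp add: exp_minus field_simps)
  have "- 1 / exp 1 \<le> lambert_arg B N0 (h k) (T k) \<nu> \<and>
          1 + lambert_W (lambert_arg B N0 (h k) (T k) \<nu>) \<noteq> 0 \<longleftrightarrow> \<nu> > 0" if "k \<in> {1..K}" for k
    using W lambert_W_gt_minus_one[of "lambert_arg B N0 (h k) (T k) \<nu>"]
      lambert_arg_gt[of B N0 "h k" "T k" \<nu>] assms that
    by (cases "lambert_arg B N0 (h k) (T k) \<nu> = - 1 / exp 1") auto
  then show ?thesis
    using assms(1) unfolding nu_equation_def by (metis atLeastAtMost_iff order_refl)
qed

locale device =
  fixes B L N0 :: real and h T \<beta> :: "nat \<Rightarrow> real" and k :: nat
  assumes pos: "B > 0" "L > 0" "N0 > 0" "h k > 0" "T k > 0" and active: "\<beta> k = 1"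
begin

lemma gamma_star_pos:
  assumes "\<nu> > 0"
  shows "gamma_star B L N0 h \<beta> T \<nu> k > 0"
  using lambert_W_lambert_arg_gt[of B N0 "h k" "T k" \<nu>] pos active assms
  by (simp add: gamma_star_def)

text \<open>With \<open>w\<close> the Lambert value, the exponent in the slope is
  \<open>1 + w\<close>, so its bracket is \<open>- (w * exp w) * exp 1 - 1\<close>; the defining
  equation of \<open>w\<close> then makes it linear in \<nu>.\<close>

lemma energy_slope_gamma_star:
  assumes "\<nu> > 0"
  shows "energy_slope B L N0 (h k) (gamma_star B L N0 h \<beta> T \<nu> k * T k) * T k = - \<nu>"
proof -
  define w where "w = lambert_W (lambert_arg B N0 (h k) (T k) \<nu>)"
  have w: "w > -1" "w * exp w = lambert_arg B N0 (h k) (T k) \<nu>"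
    using lambert_W_lambert_arg_gt[of B N0 "h k" "T k" \<nu>] lambert_arg_gt[of B N0 "h k" "T k" \<nu>]
      lambert_W(2)[of "lambert_arg B N0 (h k) (T k) \<nu>"] pos assms
    by (auto simp: w_def)
  have "gamma_star B L N0 h \<beta> T \<nu> k * T k = L * ln 2 / (B * (1 + w))"
    using pos active by (simp add: gamma_star_def w_def)
  then have x: "L * ln 2 / (B * (gamma_star B L N0 h \<beta> T \<nu> k * T k)) = 1 + w"
    using pos w by simp
  have "(1 - (1 + w)) * exp (1 + w) - 1 = - (h k)\<^sup>2 * \<nu> / (B * T k * N0)"
  proof -
    have "(1 - (1 + w)) * exp (1 + w) = - (w * exp w) * exp 1"
      by (simp add: exp_add)
    also have "\<dots> = - ((h k)\<^sup>2 * \<nu> - B * T k * N0) / (B * T k * N0)"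
      unfolding w(2) by (simp add: lambert_arg_def del: minus_diff_eq)
    also have "\<dots> = 1 - (h k)\<^sup>2 * \<nu> / (B * T k * N0)"
      using pos by (simp add: field_simps)
    finally show ?thesis by simp
  qed
  then show ?thesis
    unfolding energy_slope_def x using pos by simp
qed

lemma gamma_star_strict_antimono:
  assumes "0 < \<mu>" "\<mu> < \<nu>"
  shows "gamma_star B L N0 h \<beta> T \<nu> k < gamma_star B L N0 h \<beta> T \<mu> k"
proof -
  have "lambert_W (lambert_arg B N0 (h k) (T k) \<mu>) < lambert_W (lambert_arg B N0 (h k) (T k) \<nu>)"
    using pos assms
    by (intro lambert_W_strict_mono lambert_arg_strict_mono less_imp_le)
       (auto simp: lambert_arg_gt)
  then show ?thesis
    using pos active assms lambert_W_lambert_arg_gt[of B N0 "h k" "T k" \<mu>]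
    unfolding gamma_star_def by (intro divide_strict_left_mono) auto
qed

lemma gamma_star_antimono:
  assumes "0 < \<mu>" "\<mu> \<le> \<nu>"
  shows "gamma_star B L N0 h \<beta> T \<nu> k \<le> gamma_star B L N0 h \<beta> T \<mu> k"
  using gamma_star_strict_antimono[of \<mu> \<nu>] assms by (cases "\<mu> = \<nu>") auto

lemma isCont_gamma_star:
  assumes "\<nu> > 0"
  shows "isCont (\<lambda>\<nu>. gamma_star B L N0 h \<beta> T \<nu> k) \<nu>"
proof -
  have "isCont (\<lambda>\<nu>. lambert_arg B N0 (h k) (T k) \<nu>) \<nu>"
    unfolding lambert_arg_def using pos by (auto intro!: continuous_intros)
  then have "isCont (\<lambda>\<nu>. lambert_W (lambert_arg B N0 (h k) (T k) \<nu>)) \<nu>"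
    using pos assms by (intro isCont_o2[OF _ isCont_lambert_W]) (auto simp: lambert_arg_gt)
  then show ?thesis
    unfolding gamma_star_def
    using pos lambert_W_lambert_arg_gt[of B N0 "h k" "T k" \<nu>] assms
    by (auto intro!: continuous_intros)
qed

lemma gamma_star_surj:
  assumes "g > 0"
  obtains \<nu> where "\<nu> > 0" "gamma_star B L N0 h \<beta> T \<nu> k = g"
proof
  \<comment> \<open>\<open>x\<close> is the exponent belonging to the fraction \<open>g\<close> at
    full time, and \<nu> is the negative of the marginal energy there, written explicitly.\<close>
  define x where "x = L * ln 2 / (B * T k * g)"
  define \<nu> where "\<nu> = B * T k * N0 * (1 + (x - 1) * exp x) / (h k)\<^sup>2"
  have x: "x > 0" using pos assms by (simp add: x_def)
  have "- 1 / exp 1 < (x - 1) * exp (x - 1)"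
    using mult_exp_strict_mono[of "- 1" "x - 1"] x by (simp add: exp_minus field_simps)
  moreover have arg: "lambert_arg B N0 (h k) (T k) \<nu> = (x - 1) * exp (x - 1)"
    using pos by (simp add: lambert_arg_def \<nu>_def exp_diff field_simps)
  ultimately show "\<nu> > 0"
    using lambert_arg_gt[of B N0 "h k" "T k" \<nu>] pos by simp
  show "gamma_star B L N0 h \<beta> T \<nu> k = g"
    using x pos active assms unfolding gamma_star_def arg
    by (subst lambert_W_mult_exp) (auto simp: x_def)
qed

end

section \<open>Energies and partial derivatives of sums over the devices\<close>

lemma total_energy_finite:
  assumes "\<And>k. k \<in> {1..K} \<Longrightarrow> \<gamma> k * t k \<noteq> 0"
  shows "total_energy K B L N0 h \<beta> \<gamma> t =
           ereal (\<Sum>k=1..K. upload_energy B L N0 (h k) (\<beta> k) (\<gamma> k) (t k))"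
  using assms unfolding total_energy_def upload_energy_ext_def
  by (subst sum_ereal[symmetric]) (intro sum.cong; auto)

lemma total_energy_infinite:
  assumes "k \<in> {1..K}" "\<gamma> k * t k = 0"
  shows "total_energy K B L N0 h \<beta> \<gamma> t = \<infinity>"
  unfolding total_energy_def sum_Pinfty
  using assms by (auto simp: upload_energy_ext_def intro!: bexI[of _ k])

text \<open>Only the summand at \<open>k\<close> varies with \<open>y\<close>; this reduces partial
  derivatives of the Lagrangian to single devices.\<close>

lemma has_real_derivative_sum_fun_upd:
  fixes f :: "'i \<Rightarrow> real \<Rightarrow> real"
  assumes "finite A" "k \<in> A" "(f k has_real_derivative D) (at x)"
  shows "((\<lambda>y. \<Sum>j\<in>A. f j ((\<gamma>(k := y)) j)) has_real_derivative D) (at x)"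
proof -
  have "(\<Sum>j\<in>A. f j ((\<gamma>(k := y)) j)) = f k y + (\<Sum>j\<in>A - {k}. f j (\<gamma> j))" for y
    using assms by (subst sum.remove[of A k]) (auto intro!: sum.cong)
  then show ?thesis
    using DERIV_add[OF assms(3) DERIV_const] by simp
qed

subsection \<open>Optimality\<close>

locale upload_problem =
  fixes K :: nat and B L N0 :: real and h T \<beta> :: "nat \<Rightarrow> real"
  assumes K: "K \<ge> 1" and dev: "\<And>k. k \<in> {1..K} \<Longrightarrow> device B L N0 h T \<beta> k"
begin

lemma sum_gamma_star_eq_one:
  "\<exists>\<nu>>0. (\<Sum>k=1..K. gamma_star B L N0 h \<beta> T \<nu> k) = 1"
proof -
  let ?G = "gamma_star B L N0 h \<beta> T"
  \<comment> \<open>Each device has a multiplier giving it the equal share \<open>1 / K\<close>. At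
    the largest of these all shares are at most \<open>1 / K\<close>, at the smallest at least
    \<open>1 / K\<close>, so the sums bracket \<open>1\<close>.\<close>
  have "\<exists>\<nu>>0. ?G \<nu> k = 1 / K" if "k \<in> {1..K}" for k
    using device.gamma_star_surj[OF dev[OF that], of "1 / K"] K by auto
  then obtain m where m: "\<And>k. k \<in> {1..K} \<Longrightarrow> m k > 0 \<and> ?G (m k) k = 1 / K"
    by metis
  define u where "u = Max (m ` {1..K})"
  have u: "m k \<le> u" if "k \<in> {1..K}" for k
    using that by (simp add: u_def)
  define l where "l = Min (m ` {1..K})"
  have l: "l \<le> m k" if "k \<in> {1..K}" for k
    using that by (simp add: l_def)
  have "l > 0"
    using m K by (auto simp: l_def)
  have "l \<le> u" using l[of 1] u[of 1] K by simp
  have "\<exists>\<nu>\<ge>l. \<nu> \<le> u \<and> (\<Sum>k=1..K. ?G \<nu> k) = 1"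
  proof (rule IVT2')
    have "(\<Sum>k=1..K. ?G u k) \<le> (\<Sum>k=1..K. 1 / K)"
      using device.gamma_star_antimono[OF dev] m u by (intro sum_mono) metis
    then show "(\<Sum>k=1..K. ?G u k) \<le> 1" using K by simp
    have "(\<Sum>k=1..K. 1 / K) \<le> (\<Sum>k=1..K. ?G l k)"
      using device.gamma_star_antimono[OF dev] m l \<open>l > 0\<close> by (intro sum_mono) metis
    then show "1 \<le> (\<Sum>k=1..K. ?G l k)" using K by simp
    show "continuous_on {l..u} (\<lambda>\<nu>. \<Sum>k=1..K. ?G \<nu> k)"
      using \<open>l > 0\<close>
      by (intro continuous_on_sum continuous_at_imp_continuous_on ballI
            device.isCont_gamma_star[OF dev]) auto
  qed fact
  then show ?thesis using \<open>l > 0\<close> by (meson less_le_trans)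
qed

lemma sum_gamma_star_inj:
  assumes "\<mu> > 0" "\<nu> > 0"
    and "(\<Sum>k=1..K. gamma_star B L N0 h \<beta> T \<mu> k) = (\<Sum>k=1..K. gamma_star B L N0 h \<beta> T \<nu> k)"
  shows "\<mu> = \<nu>"
proof -
  have less: "(\<Sum>k=1..K. gamma_star B L N0 h \<beta> T b k) < (\<Sum>k=1..K. gamma_star B L N0 h \<beta> T a k)"
    if "0 < a" "a < b" for a b
    using K that by (intro sum_strict_mono device.gamma_star_strict_antimono[OF dev]) auto
  show ?thesis
    using less[of \<mu> \<nu>] less[of \<nu> \<mu>] assms by linarith
qed

text \<open>Strict inequality against every other feasible point yields optimality and uniqueness
  together. Points are compared on \<open>{1..K}\<close> only, since values elsewhere do not affect
  the problem.\<close>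

lemma total_energy_stationary_less:
  assumes nu: "\<nu> > 0" "(\<Sum>k=1..K. gamma_star B L N0 h \<beta> T \<nu> k) = 1"
    and feas: "feasible K T \<gamma> t"
    and ne: "\<exists>k\<in>{1..K}. \<gamma> k \<noteq> gamma_star B L N0 h \<beta> T \<nu> k \<or> t k \<noteq> T k"
  shows "total_energy K B L N0 h \<beta> (gamma_star B L N0 h \<beta> T \<nu>) T < total_energy K B L N0 h \<beta> \<gamma> t"
proof -
  let ?G = "gamma_star B L N0 h \<beta> T \<nu>"
  let ?E = "\<lambda>k. upload_energy B L N0 (h k) (\<beta> k)"
  have G: "?G k > 0" "T k > 0" if "k \<in> {1..K}" for k
    using device.gamma_star_pos[OF dev[OF that] nu(1)] device.pos[OF dev[OF that]] by auto
  have star: "total_energy K B L N0 h \<beta> ?G T = ereal (\<Sum>k=1..K. ?E k (?G k) (T k))"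
    using G by (intro total_energy_finite) (metis less_irrefl mult_eq_0_iff)
  show ?thesis
  proof (cases "\<exists>k\<in>{1..K}. \<gamma> k * t k = 0")
    \<comment> \<open>A vanishing product makes the competing energy infinite, while the claimed
      point has finite energy.\<close>
    case True
    then show ?thesis using total_energy_infinite star by fastforce
  next
    case False
    then have gt: "\<gamma> k > 0" "t k > 0" "t k \<le> T k" if "k \<in> {1..K}" for k
      using feas that unfolding feasible_def by (metis less_eq_real_def mult_eq_0_iff)+
    have less: "?E k (?G k) (T k) + \<nu> * ?G k < ?E k (\<gamma> k) (t k) + \<nu> * \<gamma> k"
      if k: "k \<in> {1..K}" and "\<gamma> k \<noteq> ?G k \<or> t k \<noteq> T k" for k
    proof -
      interpret device B L N0 h T \<beta> k by (rule dev) fact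
      show ?thesis
        unfolding active
        using pos gamma_star_pos[OF nu(1)] energy_slope_gamma_star[OF nu(1)] gt[OF k] that(2)
        by (intro upload_energy_stationary_less) auto
    qed
    \<comment> \<open>Devices whose pair agrees with the claimed one contribute equality;
      \<open>ne\<close> provides a device with strict inequality.\<close>
    have "(\<Sum>k=1..K. ?E k (?G k) (T k) + \<nu> * ?G k) < (\<Sum>k=1..K. ?E k (\<gamma> k) (t k) + \<nu> * \<gamma> k)"
    proof (rule sum_strict_mono_ex1)
      show "\<forall>k\<in>{1..K}. ?E k (?G k) (T k) + \<nu> * ?G k \<le> ?E k (\<gamma> k) (t k) + \<nu> * \<gamma> k"
        using less by (metis less_eq_real_def)
    qed (use ne less in blast)+
    then have "(\<Sum>k=1..K. ?E k (?G k) (T k)) < (\<Sum>k=1..K. ?E k (\<gamma> k) (t k))"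
      using nu(2) feas by (simp add: sum.distrib feasible_def flip: sum_distrib_left)
    then show ?thesis
      using star total_energy_finite[of K \<gamma> t] False by simp
  qed
qed

section \<open>Feasibility and the Karush-Kuhn-Tucker conditions\<close>

lemma feasible_gamma_star:
  assumes nu: "\<nu> > 0" "(\<Sum>k=1..K. gamma_star B L N0 h \<beta> T \<nu> k) = 1"
  shows "feasible K T (gamma_star B L N0 h \<beta> T \<nu>) T"
proof -
  let ?G = "gamma_star B L N0 h \<beta> T \<nu>"
  have G: "?G k > 0" "T k > 0" if "k \<in> {1..K}" for k
    using device.gamma_star_pos[OF dev[OF that] nu(1)] device.pos[OF dev[OF that]] by auto
  have "?G k \<le> 1" if "k \<in> {1..K}" for k
    using member_le_sum[of k "{1..K}" ?G] G that nu(2) by (auto simp: less_imp_le)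
  then show ?thesis
    using G nu(2) by (auto simp: feasible_def less_imp_le)
qed

lemma bandwidth_multiplier_gamma_star:
  assumes nu: "\<nu> > 0" "(\<Sum>k=1..K. gamma_star B L N0 h \<beta> T \<nu> k) = 1"
  shows "bandwidth_multiplier K B L N0 h \<beta> T (gamma_star B L N0 h \<beta> T \<nu>) T \<nu>"
proof -
  let ?G = "gamma_star B L N0 h \<beta> T \<nu>"
  let ?E = "\<lambda>k. upload_energy B L N0 (h k) (\<beta> k)"
  define S where "S k = energy_slope B L N0 (h k) (?G k * T k)" for k
  \<comment> \<open>Besides \<nu>, only the multipliers of \<open>t k \<le> T k\<close> are taken
    nonzero: each cancels the marginal energy in time, and is nonnegative because the slope is
    negative.\<close>
  define d where "d k = - (S k * ?G k)" for k
  let ?Lag = "lagrangian K B L N0 h \<beta> T \<nu> (\<lambda>_. 0) (\<lambda>_. 0) (\<lambda>_. 0) d"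
  have G: "?G k > 0" "T k > 0" if "k \<in> {1..K}" for k
    using device.gamma_star_pos[OF dev[OF that] nu(1)] device.pos[OF dev[OF that]] by auto
  have d: "d k \<ge> 0" if "k \<in> {1..K}" for k
    using energy_slope_neg[of B L N0 "h k" "?G k * T k"] G[OF that] device.pos[OF dev[OF that]]
    by (simp add: d_def S_def mult_nonpos_nonneg less_imp_le)
  have deriv:
    "((\<lambda>x. ?Lag (?G(k := x)) T) has_real_derivative 0) (at (?G k)) \<and>
     ((\<lambda>x. ?Lag ?G (T(k := x))) has_real_derivative 0) (at (T k))" if k: "k \<in> {1..K}" for k
  proof
    interpret device B L N0 h T \<beta> k by (rule dev) fact
    have ne: "?G k * T k \<noteq> 0" "T k * ?G k \<noteq> 0"
      using G[OF k] by auto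
    have "((\<lambda>x. ?E k x (T k) + \<nu> * x) has_real_derivative 0) (at (?G k))"
      using has_real_derivative_upload_energy[of B "?G k" "T k" L N0 "h k"] ne
        energy_slope_gamma_star[OF nu(1)] pos(1) active
      by (auto intro!: derivative_eq_intros)
    \<comment> \<open>The Lagrangian is regrouped into per-device terms plus a constant: the
      \<open>d\<close> terms stay fixed at zero, and \<open>- \<nu>\<close> comes from the
      right-hand side of the bandwidth constraint.\<close>
    then have "((\<lambda>x. (\<Sum>j=1..K. ?E j ((?G(k := x)) j) (T j) + \<nu> * (?G(k := x)) j)
                  + (- \<nu> + (\<Sum>j=1..K. d j * (T j - T j)))) has_real_derivative 0 + 0) (at (?G k))"
      by (intro DERIV_add DERIV_const
            has_real_derivative_sum_fun_upd[where f = "\<lambda>j x. ?E j x (T j) + \<nu> * x"])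
         (use k in auto)
    then show "((\<lambda>x. ?Lag (?G(k := x)) T) has_real_derivative 0) (at (?G k))"
      by (simp add: lagrangian_def sum.distrib sum_distrib_left right_diff_distrib
            add_diff_eq del: fun_upd_apply)
    have "((\<lambda>x. ?E k (?G k) x + d k * (x - T k)) has_real_derivative 0) (at (T k))"
      using has_real_derivative_upload_energy[of B "T k" "?G k" L N0 "h k"] ne pos(1) active
      by (auto intro!: derivative_eq_intros
            simp: d_def S_def upload_energy_commute[of _ _ _ _ "?G k"] mult.commute)
    \<comment> \<open>Now the time varies, so the bandwidth term is the constant and the
      \<open>d\<close> terms join the per-device sum.\<close>
    then have "((\<lambda>x. (\<Sum>j=1..K. ?E j (?G j) ((T(k := x)) j) + d j * ((T(k := x)) j - T j))
                  + \<nu> * ((\<Sum>j=1..K. ?G j) - 1)) has_real_derivative 0 + 0) (at (T k))"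
      by (intro DERIV_add DERIV_const
            has_real_derivative_sum_fun_upd[where f = "\<lambda>j x. ?E j (?G j) x + d j * (x - T j)"])
         (use k in auto)
    then show "((\<lambda>x. ?Lag ?G (T(k := x))) has_real_derivative 0) (at (T k))"
      by (simp add: lagrangian_def sum.distrib add_ac del: fun_upd_apply)
  qed
  show ?thesis
    unfolding bandwidth_multiplier_def
  proof (intro conjI)
    show "feasible K T ?G T" using nu by (rule feasible_gamma_star)
    show "\<forall>k\<in>{1..K}. ?G k * T k \<noteq> 0" using G by (metis less_irrefl mult_eq_0_iff)
  qed (intro exI[of _ "\<lambda>_. 0"] exI[of _ d]; use d deriv in auto)
qed

end

theorem theorem1:
  fixes K :: nat and B L N0 :: real and h T \<beta> :: "nat \<Rightarrow> real"
  assumes "K \<ge> 1" and "B > 0" and "L > 0" and "N0 > 0"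
    and "\<And>k. k \<in> {1..K} \<Longrightarrow> h k > 0"
    and "\<And>k. k \<in> {1..K} \<Longrightarrow> T k > 0"
    and "\<And>k. k \<in> {1..K} \<Longrightarrow> \<beta> k = 1"
  shows "(\<exists>!\<nu>. nu_equation K B L N0 h \<beta> T \<nu>) \<and>
    (\<forall>\<nu>. nu_equation K B L N0 h \<beta> T \<nu> \<longrightarrow>
       optimal_solution K B L N0 h \<beta> T (gamma_star B L N0 h \<beta> T \<nu>) T \<and>
       (\<forall>\<gamma> t. optimal_solution K B L N0 h \<beta> T \<gamma> t \<longrightarrow>
          (\<forall>k\<in>{1..K}. \<gamma> k = gamma_star B L N0 h \<beta> T \<nu> k \<and> t k = T k)) \<and>
       bandwidth_multiplier K B L N0 h \<beta> T (gamma_star B L N0 h \<beta> T \<nu>) T \<nu>)"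
proof -
  interpret upload_problem K B L N0 h T \<beta>
    using assms by unfold_locales auto
  have nu_iff: "nu_equation K B L N0 h \<beta> T \<nu> \<longleftrightarrow>
      \<nu> > 0 \<and> (\<Sum>k=1..K. gamma_star B L N0 h \<beta> T \<nu> k) = 1" for \<nu>
    using assms by (intro nu_equation_iff)
  have "\<exists>!\<nu>. nu_equation K B L N0 h \<beta> T \<nu>"
    unfolding nu_iff
  proof (rule ex_ex1I)
    show "\<exists>\<nu>>0. (\<Sum>k=1..K. gamma_star B L N0 h \<beta> T \<nu> k) = 1"
      by (rule sum_gamma_star_eq_one)
  qed (auto intro: sum_gamma_star_inj)
  moreover have "optimal_solution K B L N0 h \<beta> T (gamma_star B L N0 h \<beta> T \<nu>) T \<and>
       (\<forall>\<gamma> t. optimal_solution K B L N0 h \<beta> T \<gamma> t \<longrightarrow>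
          (\<forall>k\<in>{1..K}. \<gamma> k = gamma_star B L N0 h \<beta> T \<nu> k \<and> t k = T k)) \<and>
       bandwidth_multiplier K B L N0 h \<beta> T (gamma_star B L N0 h \<beta> T \<nu>) T \<nu>"
    if "nu_equation K B L N0 h \<beta> T \<nu>" for \<nu>
  proof (intro conjI)
    have nu: "\<nu> > 0" "(\<Sum>k=1..K. gamma_star B L N0 h \<beta> T \<nu> k) = 1"
      using that by (auto simp: nu_iff)
    note feas = feasible_gamma_star[OF nu]
    note less = total_energy_stationary_less[OF nu]
    show "bandwidth_multiplier K B L N0 h \<beta> T (gamma_star B L N0 h \<beta> T \<nu>) T \<nu>"
      using nu by (rule bandwidth_multiplier_gamma_star)
    show "\<forall>\<gamma> t. optimal_solution K B L N0 h \<beta> T \<gamma> t \<longrightarrow>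
          (\<forall>k\<in>{1..K}. \<gamma> k = gamma_star B L N0 h \<beta> T \<nu> k \<and> t k = T k)"
      using feas less unfolding optimal_solution_def by (meson leD)
    have "total_energy K B L N0 h \<beta> (gamma_star B L N0 h \<beta> T \<nu>) T \<le> total_energy K B L N0 h \<beta> \<gamma> t"
      if "feasible K T \<gamma> t" for \<gamma> t
    proof (cases "\<exists>k\<in>{1..K}. \<gamma> k \<noteq> gamma_star B L N0 h \<beta> T \<nu> k \<or> t k \<noteq> T k")
      case True
      then show ?thesis using less that by (simp add: less_imp_le)
    next
      \<comment> \<open>The competitor agrees with the claimed point on \<open>{1..K}\<close>,
        though perhaps not outside, so the energies coincide summand by summand.\<close>
      case False
      then show ?thesis by (auto simp: total_energy_def intro!: sum_mono)
    qed
    then show "optimal_solution K B L N0 h \<beta> T (gamma_star B L N0 h \<beta> T \<nu>) T"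
      using feas unfolding optimal_solution_def by blast
  qed
  ultimately show ?thesis by blast
qed

end
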